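(* The space $\overline{T(\mathbf I)}$ has the strongly discrete approximation property (SDAP). Hence $T(\mathbf I)$, $T^{PL}(\mathbf I)$ and $T^{PM}(\mathbf I)$ have SDAP.
   Context: $\mathbf I=[0,1]$; $C(\mathbf I)$ is the space of continuous self-maps of $\mathbf I$ with the supremum metric $d$; $T(\mathbf I)$ is the set of transitive maps ($f$ is transitive if for all non-empty open $U,V\subset\mathbf I$ there is $n\ge1$ with $U\cap f^{-n}(V)\ne\emptyset$), $\overline{T(\mathbf I)}$ its closure, and $T^{PL}(\mathbf I)$, $T^{PM}(\mathbf I)$ the sets of piecewise linear, respectively piecewise monotone, transitive maps. A metric space $(X,d)$ has SDAP if for every continuous $\varepsilon:X\to(0,1)$, every compact metric space $K$ and every continuous $f:K\times\mathbb N\to X$ ($\mathbb N$ discrete), there exists a continuous $g:K\times\mathbb N\to X$ such that the family $\{g(K\times\{n\}):n\in\mathbb N\}$ is discrete in $X$ and $d(f(k,n),g(k,n))<\varepsilon(f(k,n))$ for all $(k,n)\in K\times\mathbb N$. *)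

theory Defs
  imports "HOL-Analysis.Analysis"
begin

text \<open>A self-map of I is represented by a function real => real; to get a canonical
representative we require it to be 0 outside I.\<close>

definition CI :: "(real \<Rightarrow> real) set" where
  "CI = {f. continuous_on {0..1} f \<and> f ` {0..1} \<subseteq> {0..1} \<and> (\<forall>x. x \<notin> {0..1} \<longrightarrow> f x = 0)}"

definition supdist :: "(real \<Rightarrow> real) \<Rightarrow> (real \<Rightarrow> real) \<Rightarrow> real" where
  "supdist f g = (SUP x\<in>{0..1}. \<bar>f x - g x\<bar>)"

definition CI_metric :: "(real \<Rightarrow> real) metric" where
  "CI_metric = metric (CI, \<lambda>f g. if f \<in> CI \<and> g \<in> CI then supdist f g else 0)"

definition transitive_map :: "(real \<Rightarrow> real) \<Rightarrow> bool" where
  "transitive_map f \<longleftrightarrow>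
     (\<forall>U V. openin (top_of_set {0..1}) U \<and> U \<noteq> {} \<and>
            openin (top_of_set {0..1}) V \<and> V \<noteq> {} \<longrightarrow>
            (\<exists>n\<ge>1. U \<inter> {x\<in>{0..1}. (f ^^ n) x \<in> V} \<noteq> {}))"

definition TI :: "(real \<Rightarrow> real) set" where
  "TI = {f \<in> CI. transitive_map f}"

definition TI_closure :: "(real \<Rightarrow> real) set" where
  "TI_closure = mtopology_of CI_metric closure_of TI"

definition piecewise_on_I :: "(real set \<Rightarrow> bool) \<Rightarrow> bool" where
  "piecewise_on_I Q \<longleftrightarrow>
     (\<exists>P. finite P \<and> {0,1} \<subseteq> P \<and> P \<subseteq> {0..1} \<and>
          (\<forall>a\<in>P. \<forall>b\<in>P. a < b \<and> {a<..<b} \<inter> P = {} \<longrightarrow> Q {a..b}))"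

definition piecewise_linear :: "(real \<Rightarrow> real) \<Rightarrow> bool" where
  "piecewise_linear f \<longleftrightarrow>
     piecewise_on_I (\<lambda>J. \<exists>m c. \<forall>x\<in>J. f x = m * x + c)"

definition piecewise_monotone :: "(real \<Rightarrow> real) \<Rightarrow> bool" where
  "piecewise_monotone f \<longleftrightarrow>
     piecewise_on_I (\<lambda>J. mono_on J f \<or> antimono_on J f)"

definition TI_PL :: "(real \<Rightarrow> real) set" where
  "TI_PL = {f \<in> TI. piecewise_linear f}"

definition TI_PM :: "(real \<Rightarrow> real) set" where
  "TI_PM = {f \<in> TI. piecewise_monotone f}"

definition discrete_family :: "'a metric \<Rightarrow> (nat \<Rightarrow> 'a set) \<Rightarrow> bool" where
  "discrete_family m A \<longleftrightarrow>
     (\<forall>x\<in>mspace m. \<exists>r>0. \<forall>n n'. mball_of m x r \<inter> A n \<noteq> {} \<and> mball_of m x r \<inter> A n' \<noteq> {}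
                                 \<longrightarrow> n = n')"

text \<open>SDAP, where the compact metric spaces K range over compact subsets of an
arbitrary metric_space type 'k (the type is universally quantified in theorems).
Maps K x N -> X (N discrete) are curried: continuity means each F(-,n) is continuous.\<close>
definition SDAP :: "'k::metric_space itself \<Rightarrow> 'a metric \<Rightarrow> bool" where
  "SDAP (_ :: 'k itself) m \<longleftrightarrow>
     (\<forall>\<epsilon> :: 'a \<Rightarrow> real. continuous_map (mtopology_of m) euclideanreal \<epsilon> \<and>
                 \<epsilon> ` mspace m \<subseteq> {0<..<1} \<longrightarrow>
      (\<forall>(K :: 'k set) (F :: 'k \<Rightarrow> nat \<Rightarrow> 'a). compact K \<and>
         (\<forall>n. continuous_map (top_of_set K) (mtopology_of m) (\<lambda>k. F k n)) \<longrightarrow>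
         (\<exists>G :: 'k \<Rightarrow> nat \<Rightarrow> 'a.
            (\<forall>n. continuous_map (top_of_set K) (mtopology_of m) (\<lambda>k. G k n)) \<and>
            discrete_family m (\<lambda>n. (\<lambda>k. G k n) ` K) \<and>
            (\<forall>k\<in>K. \<forall>n. mdist m (F k n) (G k n) < \<epsilon> (F k n)))))"

lemma supdist_bdd:
  assumes "f \<in> CI" "g \<in> CI"
  shows "bdd_above ((\<lambda>x. \<bar>f x - g x\<bar>) ` {0..1})"
proof -
  have "\<bar>f x - g x\<bar> \<le> 1" if x: "x \<in> {0..1}" for x
  proof -
    have "f x \<in> {0..1}" "g x \<in> {0..1}" using assms x unfolding CI_def image_subset_iff by blast+
    then show ?thesis by auto
  qed
  then show ?thesis by (intro bdd_aboveI[where M=1]) auto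
qed

lemma supdist_ge:
  assumes "f \<in> CI" "g \<in> CI" "x \<in> {0..1}"
  shows "\<bar>f x - g x\<bar> \<le> supdist f g"
  unfolding supdist_def by (rule cSUP_upper[OF assms(3) supdist_bdd[OF assms(1,2)]])

lemma supdist_nonneg: "f \<in> CI \<Longrightarrow> g \<in> CI \<Longrightarrow> 0 \<le> supdist f g"
  using supdist_ge[of f g 0] abs_ge_zero[of "f 0 - g 0"] by simp

lemma Metric_space_CI: "Metric_space CI (\<lambda>f g. if f \<in> CI \<and> g \<in> CI then supdist f g else 0)"
proof
  fix f g
  show "0 \<le> (if f \<in> CI \<and> g \<in> CI then supdist f g else 0)"
    using supdist_nonneg by auto
  show "(if f \<in> CI \<and> g \<in> CI then supdist f g else 0) = (if g \<in> CI \<and> f \<in> CI then supdist g f else 0)"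
    unfolding supdist_def by (auto simp: abs_minus_commute)
next
  fix f g assume f: "f \<in> CI" and g: "g \<in> CI"
  show "((if f \<in> CI \<and> g \<in> CI then supdist f g else 0) = 0) = (f = g)"
  proof
    assume "(if f \<in> CI \<and> g \<in> CI then supdist f g else 0) = 0"
    then have 0: "supdist f g = 0" using f g by simp
    show "f = g"
    proof
      fix x show "f x = g x"
      proof (cases "x \<in> {0..1}")
        case True then show ?thesis using supdist_ge[OF f g True] 0 by simp
      next
        case False then show ?thesis using f g unfolding CI_def by auto
      qed
    qed
  qed (simp add: supdist_def)
next
  fix f g h assume f: "f \<in> CI" and g: "g \<in> CI" and h: "h \<in> CI"
  have "supdist f h \<le> supdist f g + supdist g h"
    unfolding supdist_def[of f h]
  proof (rule cSUP_least)
    show "{0..1::real} \<noteq> {}" by simp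
    fix x :: real assume x: "x \<in> {0..1}"
    have "\<bar>f x - h x\<bar> \<le> \<bar>f x - g x\<bar> + \<bar>g x - h x\<bar>" by simp
    also have "\<dots> \<le> supdist f g + supdist g h"
      using supdist_ge[OF f g x] supdist_ge[OF g h x] by simp
    finally show "\<bar>f x - h x\<bar> \<le> supdist f g + supdist g h" .
  qed
  then show "(if f \<in> CI \<and> h \<in> CI then supdist f h else 0) \<le>
      (if f \<in> CI \<and> g \<in> CI then supdist f g else 0) + (if g \<in> CI \<and> h \<in> CI then supdist g h else 0)"
    using f g h by simp
qed

lemma mspace_CI_metric [simp]: "mspace CI_metric = CI"
  and mdist_CI_metric: "mdist CI_metric = (\<lambda>f g. if f \<in> CI \<and> g \<in> CI then supdist f g else 0)"
  unfolding CI_metric_def using Metric_space_CI by (auto simp: Metric_space.mspace_metric Metric_space.mdist_metric)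

end

theory Submission
  imports Defs
begin

text \<open>
  All four spaces lie between \<open>TI_PL\<close> and \<open>TI_closure\<close>, and the argument works for every such space.
  A map \<open>f\<close> is replaced by the piecewise linear map with nodes \<open>k / L\<close> whose values there are
  alternately \<open>f + t\<close> and \<open>f - t\<close>, truncated to the unit interval, where \<open>t = \<epsilon>(f) / 4\<close>.
  This map depends continuously on \<open>f\<close>, and for large \<open>L\<close> (uniformly on compact sets of maps) it is
  transitive: since every lap is steep, each interval grows under iteration until it covers a lap; and the
  image of a lap contains a \<open>t/2\<close>-neighbourhood of its \<open>f\<close>-image, so the laps visited by an orbit
  of a transitive map close to \<open>f\<close> are covered one after the other.

  The values at \<open>0\<close> and \<open>1 / L\<close> differ by at least \<open>t\<close>. Letting \<open>L\<close> grow fast enough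
  with the index \<open>n\<close> makes the images of \<open>K\<close> disjoint, and a sequence of maps from different images
  cannot converge to some \<open>g\<close>: either \<open>t\<close> stays bounded below, which contradicts continuity of \<open>g\<close>
  at \<open>0\<close>, or the original maps also approach \<open>g\<close> and \<open>\<epsilon>(g) = 0\<close>.
\<close>

section \<open>Piecewise linear interpolation at equidistant nodes\<close>

text \<open>A sum of hat functions centred at the nodes \<open>k / L\<close>, which makes continuity
  immediate. The value 0 outside the unit interval is the convention of \<open>CI\<close>.\<close>

definition pl_interp :: "nat \<Rightarrow> (nat \<Rightarrow> real) \<Rightarrow> real \<Rightarrow> real" where
  "pl_interp L v x = (if x \<in> {0..1} then \<Sum>k\<le>L. v k * max 0 (1 - \<bar>real L * x - real k\<bar>) else 0)"

definition lap :: "nat \<Rightarrow> nat \<Rightarrow> real set" where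
  "lap L k = {real k / real L .. (real k + 1) / real L}"

text \<open>For \<open>f\<close> in \<open>CI\<close> and \<open>t > 0\<close> a raised value can
  leave the unit interval only at 1 and a lowered one only at 0, hence one truncation in each
  case.\<close>

definition zigzag :: "nat \<Rightarrow> (real \<Rightarrow> real) \<Rightarrow> real \<Rightarrow> nat \<Rightarrow> real" where
  "zigzag L f t k = (if even k then min 1 (f (real k / real L) + t) else max 0 (f (real k / real L) - t))"

lemma lap_iff: "L > 0 \<Longrightarrow> x \<in> lap L k \<longleftrightarrow> real k \<le> real L * x \<and> real L * x \<le> real k + 1"
  by (auto simp: lap_def field_simps)

lemma lap_subset_unit: "k < L \<Longrightarrow> lap L k \<subseteq> {0..1}"
  by (auto simp: lap_def field_simps)

lemma lap_exists:
  assumes "L > 0" "x \<in> {0..1}"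
  obtains k where "k < L" "x \<in> lap L k"
\<comment> \<open>At \<open>x = 1\<close> the floor used below would give the index
  \<open>L\<close>, one too large; the last lap takes this point.\<close>
proof (cases "x = 1")
  case True
  then have "x \<in> lap L (L - 1)" using assms(1) by (simp add: lap_iff of_nat_diff)
  then show ?thesis using that[of "L - 1"] assms by simp
next
  case False
  define k where "k = nat \<lfloor>real L * x\<rfloor>"
  have nn: "0 \<le> real L * x" using assms by simp
  have k: "real k \<le> real L * x" "real L * x < real k + 1"
    using nn unfolding k_def by linarith+
  have "real L * x < real L" using False assms by simp
  then have "k < L" using k by linarith
  then show ?thesis using that[of k] k assms by (simp add: lap_iff)
qed

text \<open>The hat at node \<open>j\<close> vanishes where \<open>L * x\<close> is at least 1 away
  from \<open>j\<close>, so on lap \<open>k\<close> only the hats \<open>k\<close> and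
  \<open>Suc k\<close> contribute.\<close>

lemma pl_interp_on_lap:
  assumes "k < L" "x \<in> lap L k"
  shows "pl_interp L v x = v k + (real L * x - real k) * (v (Suc k) - v k)"
proof -
  have x: "x \<in> {0..1}" using lap_subset_unit assms by blast
  have kx: "real k \<le> real L * x" "real L * x \<le> real k + 1" using assms lap_iff[of L x k] by auto
  have "(\<Sum>j\<le>L. v j * max 0 (1 - \<bar>real L * x - real j\<bar>)) =
        (\<Sum>j\<in>{k, Suc k}. v j * max 0 (1 - \<bar>real L * x - real j\<bar>))"
  proof (rule sum.mono_neutral_right)
    show "\<forall>j\<in>{..L} - {k, Suc k}. v j * max 0 (1 - \<bar>real L * x - real j\<bar>) = 0"
    proof
      fix j assume "j \<in> {..L} - {k, Suc k}"
      then have "j + 1 \<le> k \<or> k + 2 \<le> j" by auto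
      then have "real j + 1 \<le> real k \<or> real k + 2 \<le> real j" by linarith
      then have "1 - \<bar>real L * x - real j\<bar> \<le> 0" using kx by linarith
      then show "v j * max 0 (1 - \<bar>real L * x - real j\<bar>) = 0" by simp
    qed
  qed (use assms in auto)
  also have "\<dots> = v k + (real L * x - real k) * (v (Suc k) - v k)"
    using kx by (simp add: max_def algebra_simps)
  finally show ?thesis using x by (simp add: pl_interp_def)
qed

text \<open>The weight \<open>u\<close> depends on \<open>x\<close> alone. With \<open>v\<close>
  quantified inside, interpolants of different node values can be compared with the same
  weights.\<close>

lemma pl_interp_convex:
  assumes "k < L" "x \<in> lap L k"
  obtains u where "0 \<le> u" "u \<le> 1" "\<And>v. pl_interp L v x = (1 - u) * v k + u * v (Suc k)"
proof -
  have "real k \<le> real L * x" "real L * x \<le> real k + 1" using assms lap_iff[of L x k] by auto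
  then show ?thesis
    using that[of "real L * x - real k"] pl_interp_on_lap[OF assms] by (simp add: algebra_simps)
qed

lemma pl_interp_node:
  assumes "L > 0" "k \<le> L"
  shows "pl_interp L v (real k / real L) = v k"
proof (cases "k < L")
  case True
  have "real k / real L \<in> lap L k" using assms by (simp add: lap_iff)
  then show ?thesis using pl_interp_on_lap[OF True] assms by simp
next
  case False
  then obtain j where j: "k = Suc j" "k = L" using assms by (cases k) auto
  have "real k / real L \<in> lap L j" using j by (simp add: lap_def)
  then show ?thesis using pl_interp_on_lap[of j L] j by simp
qed

lemma convex_comb_abs_le:
  fixes u a b c d :: real
  assumes "0 \<le> u" "u \<le> 1" "\<bar>a - c\<bar> \<le> d" "\<bar>b - c\<bar> \<le> d"
  shows "\<bar>((1 - u) * a + u * b) - c\<bar> \<le> d"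
proof -
  have "((1 - u) * a + u * b) - c = (1 - u) * (a - c) + u * (b - c)" by algebra
  also have "\<bar>\<dots>\<bar> \<le> (1 - u) * \<bar>a - c\<bar> + u * \<bar>b - c\<bar>"
    using assms(1,2) abs_triangle_ineq[of "(1 - u) * (a - c)" "u * (b - c)"] by (simp add: abs_mult)
  also have "\<dots> \<le> (1 - u) * d + u * d" using assms by (intro add_mono mult_left_mono) auto
  also have "\<dots> = d" by (simp add: algebra_simps)
  finally show ?thesis .
qed

lemma pl_interp_diff_le:
  assumes "L > 0" "x \<in> {0..1}" "\<And>k. k \<le> L \<Longrightarrow> \<bar>v k - w k\<bar> \<le> d"
  shows "\<bar>pl_interp L v x - pl_interp L w x\<bar> \<le> d"
proof -
  obtain k where k: "k < L" "x \<in> lap L k" using lap_exists assms by blast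
  obtain u where u: "0 \<le> u" "u \<le> 1" "\<And>v. pl_interp L v x = (1 - u) * v k + u * v (Suc k)"
    using pl_interp_convex[OF k] by blast
  have "\<bar>((1 - u) * (v k - w k) + u * (v (Suc k) - w (Suc k))) - 0\<bar> \<le> d"
    using k assms(3)[of k] assms(3)[of "Suc k"] by (intro convex_comb_abs_le u) auto
  then show ?thesis by (simp add: u(3) algebra_simps)
qed

lemma pl_interp_in_CI:
  assumes "L > 0" "\<And>k. k \<le> L \<Longrightarrow> v k \<in> {0..1}"
  shows "pl_interp L v \<in> CI"
proof -
  have "continuous_on {0..1} (\<lambda>x. \<Sum>k\<le>L. v k * max 0 (1 - \<bar>real L * x - real k\<bar>))"
    by (intro continuous_intros)
  then have "continuous_on {0..1} (pl_interp L v)"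
    by (rule continuous_on_eq) (simp add: pl_interp_def)
  moreover have "pl_interp L v x \<in> {0..1}" if x: "x \<in> {0..1}" for x
  proof -
    obtain k where k: "k < L" "x \<in> lap L k" using lap_exists assms x by blast
    obtain u where u: "0 \<le> u" "u \<le> 1" "\<And>v. pl_interp L v x = (1 - u) * v k + u * v (Suc k)"
      using pl_interp_convex[OF k] by blast
    have "v k \<in> {0..1}" "v (Suc k) \<in> {0..1}" using k(1) assms(2) by simp_all
    \<comment> \<open>Lying in the unit interval means distance at most 1/2 from 1/2, the form that
      \<open>convex_comb_abs_le\<close> handles.\<close>
    then have "\<bar>v k - 1/2\<bar> \<le> 1/2" "\<bar>v (Suc k) - 1/2\<bar> \<le> 1/2"
      unfolding atLeastAtMost_iff abs_le_iff by linarith+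
    then have "\<bar>((1 - u) * v k + u * v (Suc k)) - 1/2\<bar> \<le> 1/2"
      by (intro convex_comb_abs_le u)
    then have "\<bar>pl_interp L v x - 1/2\<bar> \<le> 1/2" by (simp only: u(3))
    then show ?thesis unfolding atLeastAtMost_iff abs_le_iff by linarith
  qed
  moreover have "pl_interp L v x = 0" if "x \<notin> {0..1}" for x
    using that by (simp only: pl_interp_def if_False)
  ultimately show ?thesis unfolding CI_def by blast
qed

lemma pl_interp_piecewise_linear:
  assumes "L > 0"
  shows "piecewise_linear (pl_interp L v)"
proof -
  define P where "P = (\<lambda>k. real k / real L) ` {..L}"
  have "\<exists>m c. \<forall>x\<in>{a..b}. pl_interp L v x = m * x + c"
    if a: "a \<in> P" and b: "b \<in> P" and ab: "a < b" "{a<..<b} \<inter> P = {}" for a b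
  proof -
    obtain i j where ij: "a = real i / real L" "b = real j / real L" "i \<le> L" "j \<le> L"
      using a b by (auto simp: P_def)
    have lt: "i < j" using ab ij assms by (simp add: divide_less_cancel)
    have "j = Suc i"
    proof (rule ccontr)
      assume "j \<noteq> Suc i"
      then have "Suc i < j" using lt by simp
      then have "real (Suc i) / real L \<in> {a<..<b}"
        using ij assms by (auto simp: divide_strict_right_mono)
      moreover have "real (Suc i) / real L \<in> P"
        unfolding P_def using \<open>Suc i < j\<close> ij(4) by (intro imageI) simp
      ultimately show False using ab by blast
    qed
    then have "{a..b} = lap L i" "i < L" using ij by (auto simp: lap_def add.commute)
    then have "\<forall>x\<in>{a..b}. pl_interp L v x = (real L * (v (Suc i) - v i)) * x + (v i - real i * (v (Suc i) - v i))"
      using pl_interp_on_lap[of i L _ v] by (simp add: algebra_simps)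
    then show ?thesis by blast
  qed
  moreover have "finite P" "{0,1} \<subseteq> P" "P \<subseteq> {0..1}"
  proof -
    show "finite P" by (simp add: P_def)
    have "0 \<in> P" unfolding P_def by (rule image_eqI[of _ _ 0]) auto
    moreover have "1 \<in> P" unfolding P_def by (rule image_eqI[of _ _ L]) (use assms in auto)
    ultimately show "{0,1} \<subseteq> P" by simp
    show "P \<subseteq> {0..1}" using assms by (auto simp: P_def)
  qed
  ultimately show ?thesis
    unfolding piecewise_linear_def piecewise_on_I_def by (intro exI[of _ P] conjI ballI impI) auto
qed

lemma pl_interp_lap_image:
  assumes "k < L"
  shows "{min (v k) (v (Suc k)) .. max (v k) (v (Suc k))} \<subseteq> pl_interp L v ` lap L k"
proof
  fix y assume y: "y \<in> {min (v k) (v (Suc k)) .. max (v k) (v (Suc k))}"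
  then have "y \<in> closed_segment (v k) (v (Suc k))"
    by (auto simp: closed_segment_eq_real_ivl min_def max_def split: if_splits)
  then obtain u where u: "0 \<le> u" "u \<le> 1" "y = (1 - u) * v k + u * v (Suc k)"
    by (auto simp: in_segment)
  define x where "x = (real k + u) / real L"
  have Lx: "real L * x = real k + u" using assms by (simp add: x_def)
  then have "x \<in> lap L k" using assms u by (simp add: lap_iff)
  moreover have "pl_interp L v x = y"
    unfolding pl_interp_on_lap[OF assms \<open>x \<in> lap L k\<close>] Lx u(3) by (simp add: algebra_simps)
  ultimately show "y \<in> pl_interp L v ` lap L k" by blast
qed

lemma pl_interp_on_lap_diff:
  assumes "k < L" "x \<in> lap L k" "y \<in> lap L k"
  shows "\<bar>pl_interp L v x - pl_interp L v y\<bar> = real L * \<bar>v (Suc k) - v k\<bar> * \<bar>x - y\<bar>"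
proof -
  have "pl_interp L v x - pl_interp L v y = real L * (v (Suc k) - v k) * (x - y)"
    using pl_interp_on_lap[OF assms(1,2), of v] pl_interp_on_lap[OF assms(1,3), of v] by (simp add: algebra_simps)
  then show ?thesis by (simp add: abs_mult)
qed

section \<open>Growth of intervals under a steep interpolant\<close>

text \<open>The midpoint lies in a lap that is not contained in \<open>{a..b}\<close>; this lap
  sticks out on one side and so contains half of the interval. There the slope is at least 4 in
  absolute value, so the image of this half has length at least \<open>2 * (b - a)\<close>.\<close>

lemma pl_interp_expands:
  assumes g: "g = pl_interp L v" "g \<in> CI"
    and steep: "\<And>k. k < L \<Longrightarrow> real L * \<bar>v (Suc k) - v k\<bar> \<ge> 4"
    and L: "L > 0" and ab: "0 \<le> a" "a < b" "b \<le> 1"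
    and nolap: "\<And>k. k < L \<Longrightarrow> \<not> lap L k \<subseteq> {a..b}"
  obtains c d where "0 \<le> c" "d \<le> 1" "d - c \<ge> 2 * (b - a)" "{c..d} \<subseteq> g ` {a..b}"
proof -
  define m where "m = (a + b) / 2"
  have m: "a < m" "m < b" "m \<in> {0..1}" using ab by (auto simp: m_def)
  obtain k where k: "k < L" "m \<in> lap L k" using lap_exists L m by blast
  have "\<exists>p q. p \<in> lap L k \<and> q \<in> lap L k \<and> a \<le> p \<and> p < q \<and> q \<le> b \<and> q - p = (b - a) / 2"
  proof (cases "real k / real L \<le> a")
    case True
    then have "a \<in> lap L k" using k m by (auto simp: lap_def)
    then show ?thesis using k m by (intro exI[of _ a] exI[of _ m]) (auto simp: m_def field_simps)
  next
    case False
    then have "b \<in> lap L k" using k m nolap[OF k(1)] by (auto simp: lap_def)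
    then show ?thesis using k m by (intro exI[of _ m] exI[of _ b]) (auto simp: m_def field_simps)
  qed
  then obtain p q where pq: "p \<in> lap L k" "q \<in> lap L k" "a \<le> p" "p < q" "q \<le> b" "q - p = (b - a) / 2"
    by blast
  have "\<bar>g p - g q\<bar> = real L * \<bar>v (Suc k) - v k\<bar> * (q - p)"
    using pl_interp_on_lap_diff[OF k(1) pq(1,2)] pq(4) g by simp
  also have "\<dots> \<ge> 4 * (q - p)" using steep[OF k(1)] pq(4) by (intro mult_right_mono) auto
  finally have len: "\<bar>g p - g q\<bar> \<ge> 2 * (b - a)" using pq(6) by simp
  have cont: "continuous_on {p..q} g"
    using g(2) pq ab by (auto simp: CI_def intro: continuous_on_subset)
  have rng: "g p \<in> {0..1}" "g q \<in> {0..1}" 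
    using g(2) pq ab unfolding CI_def image_subset_iff by auto
  have "{min (g p) (g q)..max (g p) (g q)} \<subseteq> g ` {p..q}"
  proof
    fix y assume y: "y \<in> {min (g p) (g q)..max (g p) (g q)}"
    then consider "g p \<le> y" "y \<le> g q" | "g q \<le> y" "y \<le> g p" by fastforce
    then obtain z where "p \<le> z" "z \<le> q" "g z = y"
      by cases (use IVT'[of g p y q] IVT2'[of g q y p] pq(4) cont in fastforce)+
    then show "y \<in> g ` {p..q}" by force
  qed
  also have "\<dots> \<subseteq> g ` {a..b}" using pq by (intro image_mono) auto
  finally have cover: "{min (g p) (g q)..max (g p) (g q)} \<subseteq> g ` {a..b}" .
  have "0 \<le> min (g p) (g q)" "max (g p) (g q) \<le> 1" using rng by simp_all
  moreover have "max (g p) (g q) - min (g p) (g q) \<ge> 2 * (b - a)" using len by linarith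
  ultimately show ?thesis using that cover by blast
qed

text \<open>As long as no iterate covers a lap, \<open>pl_interp_expands\<close> applies again and
  at least doubles the length of an interval inside the iterate. All these intervals stay in the
  unit interval, so this must stop.\<close>

lemma pl_interp_eventually_covers_lap:
  assumes g: "g = pl_interp L v" "g \<in> CI"
    and steep: "\<And>k. k < L \<Longrightarrow> real L * \<bar>v (Suc k) - v k\<bar> \<ge> 4"
    and L: "L > 0" and ab: "0 \<le> a" "a < b" "b \<le> 1"
  shows "\<exists>n. \<exists>k<L. lap L k \<subseteq> (g ^^ n) ` {a..b}"
proof (rule ccontr)
  assume neg: "\<not> ?thesis"
  have no: "\<not> lap L k \<subseteq> (g ^^ n) ` {a..b}" if "k < L" for n k
    using neg that by blast
  have "\<exists>c d. 0 \<le> c \<and> d \<le> 1 \<and> d - c \<ge> 2 ^ n * (b - a) \<and> {c..d} \<subseteq> (g ^^ n) ` {a..b}" for n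
  proof (induction n)
    case 0
    then show ?case using ab by (intro exI[of _ a] exI[of _ b]) auto
  next
    case (Suc n)
    then obtain c d where cd: "0 \<le> c" "d \<le> 1" "d - c \<ge> 2 ^ n * (b - a)" "{c..d} \<subseteq> (g ^^ n) ` {a..b}"
      by blast
    have "0 < 2 ^ n * (b - a)" using ab by simp
    then have "c < d" using cd(3) by linarith
    moreover have "\<not> lap L k \<subseteq> {c..d}" if "k < L" for k using no[OF that, of n] cd(4) by blast
    ultimately obtain c' d' where cd': "0 \<le> c'" "d' \<le> 1" "d' - c' \<ge> 2 * (d - c)" "{c'..d'} \<subseteq> g ` {c..d}"
      using pl_interp_expands[OF g steep L cd(1) _ cd(2)] by blast
    have "{c'..d'} \<subseteq> g ` (g ^^ n) ` {a..b}" using cd'(4) cd(4) by blast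
    then have "{c'..d'} \<subseteq> (g ^^ Suc n) ` {a..b}" by (simp add: image_comp)
    moreover have "d' - c' \<ge> 2 ^ Suc n * (b - a)" using cd'(3) cd(3) by simp
    ultimately show ?case using cd'(1,2) by blast
  qed
  note grow = this
  obtain n where n: "1 / (b - a) < 2 ^ n" using real_arch_pow[of 2] by auto
  then have "1 < 2 ^ n * (b - a)" using ab by (simp add: field_simps)
  then show False using grow[of n] by auto
qed

lemma relatively_open_contains_interval:
  assumes "openin (top_of_set {0..1::real}) U" "U \<noteq> {}"
  obtains a b where "0 \<le> a" "a < b" "b \<le> 1" "{a..b} \<subseteq> U"
proof -
  obtain x where x: "x \<in> U" using assms by blast
  then have x01: "x \<in> {0..1}" using assms openin_imp_subset by blast
  obtain e where e: "e > 0" "ball x e \<inter> {0..1} \<subseteq> U"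
    using assms x by (meson openin_contains_ball)
  define a where "a = max 0 (x - e/2)"
  define b where "b = min 1 (x + e/2)"
  have "a < b" using x01 e by (auto simp: a_def b_def)
  moreover have "{a..b} \<subseteq> ball x e \<inter> {0..1}"
    using e x01 by (auto simp: a_def b_def dist_real_def)
  moreover have "0 \<le> a" "b \<le> 1" by (auto simp: a_def b_def)
  ultimately show ?thesis using that[of a b] e(2) by blast
qed

section \<open>Transitivity of the zigzag map\<close>

text \<open>The bound \<open>L * t \<ge> 8\<close> serves twice: vertical steps of size
  \<open>t\<close> become slopes of at least 8, and laps are no longer than \<open>t / 8\<close>.
  The last assumption bounds the oscillation of \<open>f\<close> on each lap.\<close>

locale fine_zigzag =
  fixes f :: "real \<Rightarrow> real" and t :: real and L :: nat
  assumes f: "f \<in> CI" and t: "0 < t" "t \<le> 1" and L: "real L * t \<ge> 8"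
    and fine: "\<And>x y. x \<in> {0..1} \<Longrightarrow> y \<in> {0..1} \<Longrightarrow> \<bar>x - y\<bar> \<le> 1 / real L \<Longrightarrow> \<bar>f x - f y\<bar> \<le> t / 8"
begin

abbreviation "v \<equiv> zigzag L f t"
abbreviation "g \<equiv> pl_interp L v"

lemma L_pos: "L > 0"
  using L t by (cases L) auto

lemma node_in_unit: "k \<le> L \<Longrightarrow> real k / real L \<in> {0..1}"
  using L_pos by simp

lemma f_node: "k \<le> L \<Longrightarrow> f (real k / real L) \<in> {0..1}"
  using f node_in_unit unfolding CI_def image_subset_iff by blast

lemma adjacent_nodes: "k < L \<Longrightarrow> \<bar>f (real k / real L) - f (real (Suc k) / real L)\<bar> \<le> t / 8"
  using L_pos by (intro fine node_in_unit) (auto simp: diff_divide_distrib[symmetric])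

lemma zigzag_in_unit: "k \<le> L \<Longrightarrow> v k \<in> {0..1}"
  using f_node[of k] t by (auto simp: zigzag_def)

lemma zigzag_near: "k \<le> L \<Longrightarrow> \<bar>v k - f (real k / real L)\<bar> \<le> t"
  using f_node[of k] t unfolding zigzag_def atLeastAtMost_iff by (cases "even k"; simp; linarith)

text \<open>Without truncation the gap is at least \<open>2 * t - t / 8\<close>. If one value is
  truncated, the other is still \<open>t\<close> away from a point of the unit interval, on the far
  side of the truncated one; if both are, the gap is 1.\<close>

lemma zigzag_upper_minus_lower:
  assumes "p \<in> {0..1}" "q \<in> {0..1}" "\<bar>p - q\<bar> \<le> t / 8"
  shows "min 1 (p + t) - max 0 (q - t) \<ge> t"
  using assms t unfolding atLeastAtMost_iff by linarith

lemma zigzag_step: "k < L \<Longrightarrow> \<bar>v (Suc k) - v k\<bar> \<ge> t"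
  using zigzag_upper_minus_lower[OF f_node f_node, of k "Suc k"]
    zigzag_upper_minus_lower[OF f_node f_node, of "Suc k" k] adjacent_nodes[of k]
  by (cases "even k") (simp_all add: zigzag_def abs_minus_commute)

lemma g_in_CI: "g \<in> CI"
  using pl_interp_in_CI L_pos zigzag_in_unit by blast

text \<open>The node values are off by at most \<open>t\<close>, and \<open>f\<close> varies by at
  most \<open>t / 8\<close> between \<open>x\<close> and the ends of its lap; convexity carries the
  sum over to \<open>x\<close>.\<close>

lemma g_near_f:
  assumes "x \<in> {0..1}"
  shows "\<bar>g x - f x\<bar> \<le> 9 / 8 * t"
proof -
  obtain k where k: "k < L" "x \<in> lap L k" using lap_exists L_pos assms by blast
  obtain u where u: "0 \<le> u" "u \<le> 1" "\<And>v. pl_interp L v x = (1 - u) * v k + u * v (Suc k)"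
    using pl_interp_convex[OF k] by blast
  have "\<bar>f (real k / real L) - f x\<bar> \<le> t / 8" "\<bar>f (real (Suc k) / real L) - f x\<bar> \<le> t / 8"
    using k assms L_pos by (intro fine node_in_unit; auto simp: lap_def add_divide_distrib)+
  then have "\<bar>v k - f x\<bar> \<le> 9 / 8 * t" "\<bar>v (Suc k) - f x\<bar> \<le> 9 / 8 * t"
    using zigzag_near[of k] zigzag_near[of "Suc k"] k by linarith+
  then show ?thesis unfolding u(3) by (intro convex_comb_abs_le u)
qed

text \<open>One end of the lap carries a raised value and the other a lowered one. Since
  \<open>t / 2 + t / 8 \<le> t\<close>, these enclose \<open>y\<close>, and truncation cannot pass
  \<open>y\<close> because \<open>y\<close> lies in the unit interval.\<close>

lemma lap_image_covers:
  assumes "k < L" "y \<in> {0..1}" "\<bar>y - f (real k / real L)\<bar> \<le> t / 2"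
  shows "y \<in> g ` lap L k"
proof -
  define p q where "p = f (real k / real L)" and "q = f (real (Suc k) / real L)"
  have "max 0 (p - t) \<le> y" "y \<le> min 1 (p + t)" "max 0 (q - t) \<le> y" "y \<le> min 1 (q + t)"
    using assms adjacent_nodes[of k] t unfolding p_def q_def atLeastAtMost_iff by linarith+
  then have "y \<in> {min (v k) (v (Suc k)) .. max (v k) (v (Suc k))}"
    by (cases "even k") (simp_all add: zigzag_def p_def q_def min_le_iff_disj le_max_iff_disj)
  then show ?thesis using pl_interp_lap_image[OF assms(1)] by blast
qed

text \<open>Induction along the orbit of \<open>h\<close>: once the lap containing the current point
  is covered, its image under \<open>g\<close> covers the lap containing the next point.\<close>

lemma g_follows_orbit:
  assumes h: "h \<in> CI" "\<And>x. x \<in> {0..1} \<Longrightarrow> \<bar>h x - f x\<bar> \<le> t / 8"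
    and k: "k < L" "x \<in> lap L k"
  shows "\<exists>j<L. (h ^^ i) x \<in> lap L j \<and> lap L j \<subseteq> (g ^^ i) ` lap L k"
proof (induction i)
  case 0
  then show ?case using k by auto
next
  case (Suc i)
  then obtain j where j: "j < L" "(h ^^ i) x \<in> lap L j" "lap L j \<subseteq> (g ^^ i) ` lap L k" by blast
  define z where "z = (h ^^ i) x"
  have z: "z \<in> lap L j" "z \<in> {0..1}" using j lap_subset_unit[OF j(1)] by (auto simp: z_def)
  have "h z \<in> {0..1}" using h z unfolding CI_def image_subset_iff by blast
  then obtain j' where j': "j' < L" "h z \<in> lap L j'" using lap_exists L_pos by blast
  \<comment> \<open>Three errors of at most \<open>t / 8\<close> add up: the length of the lap of
    \<open>h z\<close>, the distance of \<open>h\<close> from \<open>f\<close>, and the oscillation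
    of \<open>f\<close> on lap \<open>j\<close>. Their sum is below the \<open>t / 2\<close> allowed
    by \<open>lap_image_covers\<close>.\<close>
  have "y \<in> g ` lap L j" if y: "y \<in> lap L j'" for y
  proof (rule lap_image_covers[OF j(1)])
    show "y \<in> {0..1}" using y lap_subset_unit[OF j'(1)] by blast
    have "\<bar>y - h z\<bar> \<le> 1 / real L" using y j'(2) by (auto simp: lap_def add_divide_distrib)
    moreover have "1 / real L \<le> t / 8" using L L_pos by (simp add: field_simps)
    moreover have "\<bar>f z - f (real j / real L)\<bar> \<le> t / 8"
      using z j(1) by (intro fine node_in_unit) (auto simp: lap_def add_divide_distrib)
    ultimately show "\<bar>y - f (real j / real L)\<bar> \<le> t / 2" using h(2)[OF z(2)] t by linarith
  qed
  then have "lap L j' \<subseteq> g ` (g ^^ i) ` lap L k" using j(3) by blast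
  then have "lap L j' \<subseteq> (g ^^ Suc i) ` lap L k" by (simp add: image_comp)
  moreover have "(h ^^ Suc i) x \<in> lap L j'" using j' by (simp add: z_def)
  ultimately show ?case using j' by blast
qed

lemma g_transitive:
  assumes h: "h \<in> TI" "\<And>x. x \<in> {0..1} \<Longrightarrow> \<bar>h x - f x\<bar> \<le> t / 8"
  shows "transitive_map g"
  unfolding transitive_map_def
proof (intro allI impI, elim conjE)
  fix U V :: "real set" assume U: "openin (top_of_set {0..1}) U" "U \<noteq> {}" and V: "openin (top_of_set {0..1}) V" "V \<noteq> {}"
  obtain a b where ab: "0 \<le> a" "a < b" "b \<le> 1" "{a..b} \<subseteq> U"
    using relatively_open_contains_interval[OF U] .
  have steep: "real L * \<bar>v (Suc k) - v k\<bar> \<ge> 4" if "k < L" for k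
  proof -
    have "real L * \<bar>v (Suc k) - v k\<bar> \<ge> real L * t" using zigzag_step[OF that] by (intro mult_left_mono) auto
    then show ?thesis using L by simp
  qed
  obtain m k where k: "k < L" "lap L k \<subseteq> (g ^^ m) ` {a..b}"
    using pl_interp_eventually_covers_lap[OF refl g_in_CI steep L_pos ab(1-3)] by blast
  \<comment> \<open>Transitivity of \<open>h\<close> concerns relatively open sets, so its orbit is
    started in the interior of the covered lap.\<close>
  define W where "W = {real k / real L<..<(real k + 1) / real L}"
  have W: "W \<subseteq> lap L k" by (auto simp: W_def lap_def)
  then have "W \<subseteq> {0..1}" using lap_subset_unit[OF k(1)] by blast
  then have "openin (top_of_set {0..1}) W" by (simp add: W_def open_subset)
  moreover have "W \<noteq> {}" using L_pos by (simp add: W_def divide_strict_right_mono not_le)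
  ultimately obtain n x where n: "n \<ge> 1" "x \<in> W" "(h ^^ n) x \<in> V"
    using h(1) V unfolding TI_def transitive_map_def by blast
  have "h \<in> CI" using h(1) by (simp add: TI_def)
  then have "(h ^^ n) x \<in> (g ^^ n) ` lap L k"
    using g_follows_orbit[OF _ h(2) k(1), of x n] n(2) W by blast
  then have "(h ^^ n) x \<in> (g ^^ n) ` (g ^^ m) ` {a..b}" using k(2) by blast
  then have "(h ^^ n) x \<in> (g ^^ (n + m)) ` {a..b}" by (simp add: image_comp funpow_add)
  then obtain y where y: "y \<in> {a..b}" "(g ^^ (n + m)) y = (h ^^ n) x" by auto
  then have "y \<in> U \<inter> {x \<in> {0..1}. (g ^^ (n + m)) x \<in> V}" using ab n(3) by auto
  \<comment> \<open>Here \<open>m\<close> may be 0; positivity of the exponent comes from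
    \<open>n \<ge> 1\<close>.\<close>
  then show "\<exists>n\<ge>1. U \<inter> {x \<in> {0..1}. (g ^^ n) x \<in> V} \<noteq> {}" using n(1) by (intro exI[of _ "n + m"]) auto
qed

end

section \<open>Continuous dependence, approximation in the closure, equicontinuity\<close>

text \<open>Both truncations are 1-Lipschitz. Together with \<open>pl_interp_diff_le\<close> this
  makes the zigzag map, for fixed \<open>L\<close>, continuous in \<open>f\<close> and
  \<open>t\<close>.\<close>

lemma zigzag_diff_le:
  "\<bar>zigzag L f t k - zigzag L f' t' k\<bar> \<le> \<bar>f (real k / real L) - f' (real k / real L)\<bar> + \<bar>t - t'\<bar>"
proof (cases "even k")
  case True
  have "\<bar>min 1 (a + t) - min 1 (b + t')\<bar> \<le> \<bar>a - b\<bar> + \<bar>t - t'\<bar>" for a b :: real by linarith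
  then show ?thesis using True by (simp add: zigzag_def)
next
  case False
  have "\<bar>max 0 (a - t) - max 0 (b - t')\<bar> \<le> \<bar>a - b\<bar> + \<bar>t - t'\<bar>" for a b :: real by linarith
  then show ?thesis using False by (simp add: zigzag_def)
qed

lemma supdist_le: "(\<And>x. x \<in> {0..1} \<Longrightarrow> \<bar>f x - g x\<bar> \<le> d) \<Longrightarrow> supdist f g \<le> d"
  unfolding supdist_def by (rule cSUP_least) auto

lemma TI_closure_subset_CI: "TI_closure \<subseteq> CI"
  using closure_of_subset_topspace[of "mtopology_of CI_metric" TI] by (simp add: TI_closure_def)

lemma TI_closure_approx:
  assumes "f \<in> TI_closure" "e > 0"
  obtains h where "h \<in> TI" "\<And>x. x \<in> {0..1} \<Longrightarrow> \<bar>h x - f x\<bar> \<le> e"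
proof -
  interpret M: Metric_space CI "mdist CI_metric"
    using Metric_space_mspace_mdist[of CI_metric] by simp
  have "f \<in> M.mtopology closure_of TI"
    using assms(1) by (simp add: TI_closure_def mtopology_of_def)
  then obtain h where h: "h \<in> TI" "h \<in> M.mball f e"
    using assms(2) unfolding M.metric_closure_of by blast
  then have fh: "f \<in> CI" "h \<in> CI" "supdist f h < e"
    by (auto simp: M.in_mball) (simp add: mdist_CI_metric)
  have "\<bar>h x - f x\<bar> \<le> e" if "x \<in> {0..1}" for x
    using supdist_ge[OF fh(1,2) that] fh(3) by linarith
  then show ?thesis using that h(1) by blast
qed

lemma piecewise_linear_imp_monotone:
  assumes "piecewise_linear f"
  shows "piecewise_monotone f"
proof -
  have "mono_on J f \<or> antimono_on J f" if lin: "\<forall>x\<in>J. f x = m * x + c" for J m c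
  proof (cases "m \<ge> 0")
    case True
    then have "mono_on J f" using lin by (intro mono_onI) (simp add: mult_left_mono)
    then show ?thesis ..
  next
    case False
    then have "antimono_on J f" using lin by (intro monotone_onI) (simp add: mult_left_mono_neg)
    then show ?thesis ..
  qed
  then show ?thesis
    using assms unfolding piecewise_linear_def piecewise_monotone_def piecewise_on_I_def by meson
qed

lemma continuous_map_mtopology_of_iff:
  "continuous_map (mtopology_of m) (mtopology_of m') f \<longleftrightarrow>
     f ` mspace m \<subseteq> mspace m' \<and>
     (\<forall>a\<in>mspace m. \<forall>e>0. \<exists>\<delta>>0. \<forall>x. x \<in> mspace m \<and> mdist m a x < \<delta> \<longrightarrow> mdist m' (f a) (f x) < e)"
  unfolding mtopology_of_def by (rule Metric_space.metric_continuous_map) auto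

lemma top_of_set_eq_mtopology_of: "top_of_set K = mtopology_of (submetric euclidean_metric K)"
  by (simp add: mtopology_of_submetric)

text \<open>The map sending \<open>(k, x)\<close> to \<open>F k x\<close> is jointly continuous on a
  compact product, hence uniformly continuous; comparing points with equal first component gives one
  modulus for the whole family.\<close>

lemma compact_family_equicontinuous:
  fixes F :: "'k::metric_space \<Rightarrow> real \<Rightarrow> real"
  assumes "compact K" and CI: "\<And>k. k \<in> K \<Longrightarrow> F k \<in> CI"
    and cont: "\<And>k e. k \<in> K \<Longrightarrow> e > 0 \<Longrightarrow> \<exists>\<delta>>0. \<forall>k'\<in>K. dist k k' < \<delta> \<longrightarrow> supdist (F k) (F k') < e"
    and "e > 0"
  obtains \<delta> where "\<delta> > 0"
    "\<And>k x y. k \<in> K \<Longrightarrow> x \<in> {0..1} \<Longrightarrow> y \<in> {0..1} \<Longrightarrow> \<bar>x - y\<bar> < \<delta> \<Longrightarrow> \<bar>F k x - F k y\<bar> < e"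
proof -
  have "continuous_on (K \<times> {0..1}) (\<lambda>(k, x). F k x)"
    unfolding continuous_on_iff
  proof (intro ballI allI impI)
    fix p :: "'k \<times> real" and \<eta> :: real assume p: "p \<in> K \<times> {0..1}" and \<eta>: "0 < \<eta>"
    obtain k x where kx: "p = (k, x)" "k \<in> K" "x \<in> {0..1}" using p by auto
    obtain \<delta>1 where \<delta>1: "\<delta>1 > 0" "\<And>k'. k' \<in> K \<Longrightarrow> dist k k' < \<delta>1 \<Longrightarrow> supdist (F k) (F k') < \<eta> / 2"
      using cont[OF kx(2), of "\<eta> / 2"] \<eta> by auto
    have "continuous_on {0..1} (F k)" using CI[OF kx(2)] by (simp add: CI_def)
    then obtain \<delta>2 where \<delta>2: "\<delta>2 > 0"
        "\<And>y. y \<in> {0..1} \<Longrightarrow> dist y x < \<delta>2 \<Longrightarrow> dist (F k y) (F k x) < \<eta> / 2"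
      unfolding continuous_on_iff using kx(3) \<eta> by (meson half_gt_zero)
    show "\<exists>\<delta>>0. \<forall>q\<in>K \<times> {0..1}. dist q p < \<delta> \<longrightarrow>
            dist (case q of (k, x) \<Rightarrow> F k x) (case p of (k, x) \<Rightarrow> F k x) < \<eta>"
    proof (intro exI[of _ "min \<delta>1 \<delta>2"] conjI ballI impI)
      fix q assume q: "q \<in> K \<times> {0..1::real}" "dist q p < min \<delta>1 \<delta>2"
      obtain k' y where ky: "q = (k', y)" "k' \<in> K" "y \<in> {0..1}" using q by auto
      have "dist k' k < \<delta>1" "dist y x < \<delta>2"
        using q(2) dist_fst_le[of q p] dist_snd_le[of q p] ky kx by auto
      then have "supdist (F k) (F k') < \<eta> / 2" "dist (F k y) (F k x) < \<eta> / 2"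
        using \<delta>1(2)[OF ky(2)] \<delta>2(2)[OF ky(3)] by (auto simp: dist_commute)
      then show "dist (case q of (k, x) \<Rightarrow> F k x) (case p of (k, x) \<Rightarrow> F k x) < \<eta>"
        using supdist_ge[OF CI[OF kx(2)] CI[OF ky(2)] ky(3)]
        unfolding kx(1) ky(1) prod.case dist_real_def by linarith
    qed (use \<delta>1 \<delta>2 in auto)
  qed
  then have "uniformly_continuous_on (K \<times> {0..1}) (\<lambda>(k, x). F k x)"
    using \<open>compact K\<close> by (intro compact_uniformly_continuous compact_Times) auto
  then obtain \<delta> where \<delta>: "\<delta> > 0" "\<And>p q. p \<in> K \<times> {0..1} \<Longrightarrow> q \<in> K \<times> {0..1} \<Longrightarrow> dist q p < \<delta> \<Longrightarrow>
      dist ((\<lambda>(k, x). F k x) q) ((\<lambda>(k, x). F k x) p) < e"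
    using \<open>e > 0\<close> unfolding uniformly_continuous_on_def by metis
  have "\<bar>F k x - F k y\<bar> < e" if "k \<in> K" "x \<in> {0..1}" "y \<in> {0..1}" "\<bar>x - y\<bar> < \<delta>" for k x y
    using \<delta>(2)[of "(k, y)" "(k, x)"] that by (simp add: dist_Pair_Pair dist_real_def)
  then show ?thesis using that \<delta>(1) by blast
qed

section \<open>A criterion for discrete families\<close>

text \<open>Near \<open>x\<close> only the sets with index below some \<open>N\<close> matter. By
  closedness a smaller ball avoids each of those that do not contain \<open>x\<close>, and by
  disjointness at most one contains \<open>x\<close>.\<close>

lemma discrete_familyI:
  assumes closed: "\<And>n. closedin (mtopology_of m) (A n)"
    and disj: "\<And>j n. j < n \<Longrightarrow> A j \<inter> A n = {}"
    and loc: "\<And>x. x \<in> mspace m \<Longrightarrow> \<exists>r>0. \<exists>N. \<forall>n\<ge>N. mball_of m x r \<inter> A n = {}"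
  shows "discrete_family m A"
  unfolding discrete_family_def
proof
  fix x assume x: "x \<in> mspace m"
  obtain r0 N where r0: "r0 > 0" "\<And>n. n \<ge> N \<Longrightarrow> mball_of m x r0 \<inter> A n = {}"
    using loc[OF x] by blast
  have "\<exists>r>0. x \<notin> A n \<longrightarrow> mball_of m x r \<inter> A n = {}" for n
  proof (cases "x \<in> A n")
    case True
    then show ?thesis by (intro exI[of _ 1]) auto
  next
    case False
    have "openin (mtopology_of m) (mspace m - A n)"
      using closed[of n] by (simp add: closedin_def)
    then obtain r where "r > 0" "mball_of m x r \<subseteq> mspace m - A n"
      using False x Metric_space.openin_mtopology[OF Metric_space_mspace_mdist, of m]
      unfolding mtopology_of_def mball_of_def by (metis DiffI)
    then show ?thesis by blast
  qed
  then obtain rr where rr: "\<And>n. rr n > 0" "\<And>n. x \<notin> A n \<Longrightarrow> mball_of m x (rr n) \<inter> A n = {}"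
    by metis
  \<comment> \<open>Inserting \<open>r0\<close> keeps the minimum defined when
    \<open>N = 0\<close>.\<close>
  define r where "r = Min (insert r0 (rr ` {..<N}))"
  have rpos: "r > 0" using r0(1) rr(1) by (simp add: r_def)
  have in_A: "x \<in> A n" if meets: "mball_of m x r \<inter> A n \<noteq> {}" for n
  proof (rule ccontr)
    assume nx: "x \<notin> A n"
    show False
    proof (cases "n < N")
      case True
      then have "r \<le> rr n" by (simp add: r_def)
      then have "mball_of m x r \<subseteq> mball_of m x (rr n)" by auto
      then show False using rr(2)[OF nx] meets by blast
    next
      case False
      have "r \<le> r0" by (simp add: r_def)
      then have "mball_of m x r \<subseteq> mball_of m x r0" by auto
      then show False using r0(2)[of n] False meets by auto
    qed
  qed
  have "n = n'" if "mball_of m x r \<inter> A n \<noteq> {}" "mball_of m x r \<inter> A n' \<noteq> {}" for n n'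
    using in_A[OF that(1)] in_A[OF that(2)] disj[of n n'] disj[of n' n] by (cases n n' rule: linorder_cases) auto
  then show "\<exists>r>0. \<forall>n n'. mball_of m x r \<inter> A n \<noteq> {} \<and> mball_of m x r \<inter> A n' \<noteq> {} \<longrightarrow> n = n'"
    using rpos by blast
qed

section \<open>Construction of the approximation\<close>

text \<open>The upper inclusion provides a transitive map close to each \<open>F k n\<close>; the
  lower one puts the piecewise linear approximants into \<open>X\<close>.\<close>

lemma SDAP_between:
  assumes lower: "TI_PL \<subseteq> X" and upper: "X \<subseteq> TI_closure"
  shows "SDAP TYPE('k::metric_space) (submetric CI_metric X)"
  unfolding SDAP_def
proof (intro allI impI, elim conjE)
  let ?m = "submetric CI_metric X"
  fix \<epsilon> :: "(real \<Rightarrow> real) \<Rightarrow> real" and K :: "'k set" and F :: "'k \<Rightarrow> nat \<Rightarrow> real \<Rightarrow> real"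
  assume \<epsilon>cont: "continuous_map (mtopology_of ?m) euclideanreal \<epsilon>"
    and \<epsilon>01: "\<epsilon> ` mspace ?m \<subseteq> {0<..<1}"
    and K: "compact K"
    and Fcont: "\<forall>n. continuous_map (top_of_set K) (mtopology_of ?m) (\<lambda>k. F k n)"
  have XCI: "X \<subseteq> CI" using upper TI_closure_subset_CI by blast
  have [simp]: "X \<inter> CI = X" using XCI by auto
  have md: "mdist CI_metric f g = supdist f g" if "f \<in> X" "g \<in> X" for f g
    using that XCI by (auto simp: mdist_CI_metric)
  have eps: "0 < \<epsilon> f" "\<epsilon> f < 1" if "f \<in> X" for f
    using \<epsilon>01 that by (auto simp: image_subset_iff)
  have FX: "F k n \<in> X" if "k \<in> K" for k n
    using Fcont that by (auto simp: continuous_map_def Pi_iff)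
  have FCI: "F k n \<in> CI" if "k \<in> K" for k n using FX[OF that] XCI by blast
  have Fnear: "\<exists>\<delta>>0. \<forall>k'\<in>K. dist k k' < \<delta> \<longrightarrow> supdist (F k n) (F k' n) < e" if "k \<in> K" "e > 0" for k n e
  proof -
    have "continuous_map (mtopology_of (submetric euclidean_metric K)) (mtopology_of ?m) (\<lambda>k. F k n)"
      using Fcont by (simp add: mtopology_of_submetric)
    then obtain \<delta> where "\<delta> > 0" "\<forall>k'. k' \<in> K \<and> dist k k' < \<delta> \<longrightarrow> mdist CI_metric (F k n) (F k' n) < e"
      unfolding continuous_map_mtopology_of_iff using \<open>k \<in> K\<close> \<open>e > 0\<close> by fastforce
    then show ?thesis using md FX that(1) by metis
  qed
  have \<epsilon>F: "continuous_on K (\<lambda>k. \<epsilon> (F k n))" for n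
    using continuous_map_compose[OF Fcont[rule_format] \<epsilon>cont, of n] by (simp add: o_def)
  \<comment> \<open>A lower bound for the amplitudes over the compact set \<open>K\<close> allows
    the number of laps to be chosen independently of \<open>k\<close>. For empty \<open>K\<close>
    the value 1 is a dummy.\<close>
  have "\<exists>e>0. \<forall>k\<in>K. e \<le> \<epsilon> (F k n) / 4" for n
  proof (cases "K = {}")
    case True
    then show ?thesis by (intro exI[of _ 1]) auto
  next
    case False
    then obtain k0 where "k0 \<in> K" "\<forall>k\<in>K. \<epsilon> (F k0 n) \<le> \<epsilon> (F k n)"
      using continuous_attains_inf[OF K False \<epsilon>F] by blast
    then show ?thesis using eps[OF FX] by (intro exI[of _ "\<epsilon> (F k0 n) / 4"]) auto
  qed
  then obtain e where e: "\<And>n. e n > 0" "\<And>n k. k \<in> K \<Longrightarrow> e n \<le> \<epsilon> (F k n) / 4" by metis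

  define good where "good n L \<longleftrightarrow> n < L \<and> (\<forall>k\<in>K. fine_zigzag (F k n) (\<epsilon> (F k n) / 4) L)" for n L
  have ev_good: "\<exists>L0. \<forall>L\<ge>L0. good n L" for n
  proof -
    obtain \<delta> where \<delta>: "\<delta> > 0"
      "\<And>k x y. k \<in> K \<Longrightarrow> x \<in> {0..1} \<Longrightarrow> y \<in> {0..1} \<Longrightarrow> \<bar>x - y\<bar> < \<delta> \<Longrightarrow> \<bar>F k n x - F k n y\<bar> < e n / 8"
      using compact_family_equicontinuous[OF K FCI Fnear, of "e n / 8"] e(1)[of n] 
      by (metis zero_less_divide_iff zero_less_numeral)
    \<comment> \<open>The three bounds give, in turn, laps shorter than \<open>\<delta>\<close>,
      \<open>L * t \<ge> 8\<close> for every amplitude \<open>t\<close>, and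
      \<open>n < L\<close>.\<close>
    obtain L0 :: nat where L0: "real L0 > max (1 / \<delta>) (max (8 / e n) (real n))"
      using reals_Archimedean2 by blast
    have "good n L" if "L \<ge> L0" for L
    proof -
      have L: "real L > 1 / \<delta>" "real L > 8 / e n" "real L > real n" using L0 that by auto
      have Ld: "1 / real L < \<delta>" using L(1,3) \<delta>(1) by (simp add: field_simps)
      have Le: "real L * e n > 8" using L(2) e(1)[of n] by (simp add: field_simps)
      have "fine_zigzag (F k n) (\<epsilon> (F k n) / 4) L" if k: "k \<in> K" for k
      proof
        show "F k n \<in> CI" using FCI k .
        show "0 < \<epsilon> (F k n) / 4" "\<epsilon> (F k n) / 4 \<le> 1" using eps[OF FX[OF k, of n]] by auto
        have "real L * e n \<le> real L * (\<epsilon> (F k n) / 4)" using e(2)[OF k] by (intro mult_left_mono) auto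
        then show "8 \<le> real L * (\<epsilon> (F k n) / 4)" using Le by linarith
        fix x y :: real assume "x \<in> {0..1}" "y \<in> {0..1}" "\<bar>x - y\<bar> \<le> 1 / real L"
        then have "\<bar>F k n x - F k n y\<bar> < e n / 8" using \<delta>(2)[OF k] Ld by simp
        then show "\<bar>F k n x - F k n y\<bar> \<le> \<epsilon> (F k n) / 4 / 8" using e(2)[OF k, of n] by linarith
      qed
      then show ?thesis using L(3) by (simp add: good_def)
    qed
    then show ?thesis by blast
  qed
  \<comment> \<open>The last inequality will separate the images: a map with \<open>L j\<close> laps
    has slope at most \<open>L j\<close> on its first lap, so over a length \<open>1 / L n\<close>
    with \<open>j < n\<close> it moves by less than \<open>e n\<close>. Monotonicity extends the
    inequality from neighbouring indices to all \<open>j < n\<close>.\<close>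
  have "\<exists>L. \<forall>n. good n (L n) \<and> (L n \<le> L (Suc n) \<and> real (L n) < real (L (Suc n)) * e (Suc n))"
  proof (rule dependent_nat_choice)
    show "\<exists>L. good 0 L" using ev_good by blast
    fix x n
    obtain L0 where L0: "\<And>L. L \<ge> L0 \<Longrightarrow> good (Suc n) L" using ev_good by blast
    obtain y0 :: nat where y0: "real x / e (Suc n) < real y0" using reals_Archimedean2 by blast
    define y where "y = max (max L0 x) y0"
    have "real x / e (Suc n) < real y" using y0 by (simp add: y_def)
    then have "real x < real y * e (Suc n)" using e(1)[of "Suc n"] by (simp add: field_simps)
    then show "\<exists>y. good (Suc n) y \<and> x \<le> y \<and> real x < real y * e (Suc n)"
      using L0[of y] by (intro exI[of _ y]) (auto simp: y_def)
  qed
  then obtain L where L: "\<And>n. good n (L n)" "\<And>n. L n \<le> L (Suc n)"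
    "\<And>n. real (L n) < real (L (Suc n)) * e (Suc n)" by blast
  have fineF: "fine_zigzag (F k n) (\<epsilon> (F k n) / 4) (L n)" if "k \<in> K" for k n
    using L(1)[of n] that by (simp add: good_def)
  have Ln: "n < L n" for n using L(1)[of n] by (simp add: good_def)
  have Lgap: "real (L j) < real (L n) * e n" if "j < n" for j n
  proof -
    obtain i where i: "n = Suc i" "j \<le> i" using \<open>j < n\<close> by (cases n) auto
    have "L j \<le> L i" using i(2) L(2) by (rule lift_Suc_mono_le[of L, rotated])
    then show ?thesis using L(3)[of i] i(1) by simp
  qed

  define G where "G k n = pl_interp (L n) (zigzag (L n) (F k n) (\<epsilon> (F k n) / 4))" for k n
  have GX: "G k n \<in> X" if k: "k \<in> K" for k n
  proof -
    interpret fine_zigzag "F k n" "\<epsilon> (F k n) / 4" "L n" using fineF k .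
    obtain h where "h \<in> TI" "\<And>x. x \<in> {0..1} \<Longrightarrow> \<bar>h x - F k n x\<bar> \<le> \<epsilon> (F k n) / 4 / 8"
      using TI_closure_approx[of "F k n" "\<epsilon> (F k n) / 4 / 8"] FX[OF k] upper t by auto
    then have "g \<in> TI_PL"
      using g_transitive g_in_CI pl_interp_piecewise_linear[OF L_pos] by (simp add: TI_PL_def TI_def)
    then show ?thesis using lower by (auto simp: G_def)
  qed
  have GCI: "G k n \<in> CI" if "k \<in> K" for k n using GX[OF that] XCI by blast
  have Gdist: "supdist (F k n) (G k n) < \<epsilon> (F k n)" if k: "k \<in> K" for k n
  proof -
    interpret fine_zigzag "F k n" "\<epsilon> (F k n) / 4" "L n" using fineF k .
    have "supdist (F k n) (G k n) \<le> 9 / 8 * (\<epsilon> (F k n) / 4)"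
      using g_near_f by (intro supdist_le) (simp add: G_def abs_minus_commute)
    then show ?thesis using eps[OF FX[OF k, of n]] by linarith
  qed
  have Gcont: "continuous_map (top_of_set K) (mtopology_of ?m) (\<lambda>k. G k n)" for n
    unfolding top_of_set_eq_mtopology_of continuous_map_mtopology_of_iff
  proof (intro conjI ballI allI impI)
    show "(\<lambda>k. G k n) ` mspace (submetric euclidean_metric K) \<subseteq> mspace ?m" using GX by auto
    fix k \<eta> assume "k \<in> mspace (submetric euclidean_metric K)" and \<eta>: "(0::real) < \<eta>"
    then have k: "k \<in> K" by simp
    obtain \<delta>1 where \<delta>1: "\<delta>1 > 0" "\<And>k'. k' \<in> K \<Longrightarrow> dist k k' < \<delta>1 \<Longrightarrow> supdist (F k n) (F k' n) < \<eta> / 3"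
      using Fnear[OF k, of "\<eta> / 3" n] \<eta> by (metis zero_less_divide_iff zero_less_numeral)
    obtain \<delta>2 where \<delta>2: "\<delta>2 > 0"
        "\<And>k'. k' \<in> K \<Longrightarrow> dist k' k < \<delta>2 \<Longrightarrow> dist (\<epsilon> (F k' n)) (\<epsilon> (F k n)) < \<eta> / 3"
      using \<epsilon>F[of n] k \<eta> unfolding continuous_on_iff by (metis zero_less_divide_iff zero_less_numeral)
    have "supdist (G k n) (G k' n) < \<eta>" if k': "k' \<in> K" "dist k k' < min \<delta>1 \<delta>2" for k'
    proof -
      have d: "supdist (F k n) (F k' n) < \<eta> / 3" "\<bar>\<epsilon> (F k n) - \<epsilon> (F k' n)\<bar> < \<eta> / 3"
        using \<delta>1(2) \<delta>2(2) k' by (auto simp: dist_commute dist_real_def abs_minus_commute)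
      have L0: "L n > 0" using Ln[of n] by simp
      \<comment> \<open>The node values move by less than \<open>\<eta> / 3\<close> through
        \<open>F\<close> and \<open>\<eta> / 12\<close> through the amplitude, which is a quarter of
        \<open>\<epsilon>\<close>.\<close>
      have "supdist (G k n) (G k' n) \<le> 2 * \<eta> / 3"
        unfolding G_def
      proof (intro supdist_le pl_interp_diff_le L0)
        fix i assume i: "i \<le> L n"
        have "real i / real (L n) \<in> {0..1}" using i L0 by simp
        then have "\<bar>F k n (real i / real (L n)) - F k' n (real i / real (L n))\<bar> < \<eta> / 3"
          using supdist_ge[OF FCI[OF k] FCI[OF k'(1)]] d(1) by (meson le_less_trans)
        then show "\<bar>zigzag (L n) (F k n) (\<epsilon> (F k n) / 4) i - zigzag (L n) (F k' n) (\<epsilon> (F k' n) / 4) i\<bar> \<le> 2 * \<eta> / 3"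
          using zigzag_diff_le[of "L n" "F k n" "\<epsilon> (F k n) / 4" i "F k' n" "\<epsilon> (F k' n) / 4"] d(2)
          by linarith
      qed auto
      then show ?thesis using \<eta> by linarith
    qed
    then show "\<exists>\<delta>>0. \<forall>x. x \<in> mspace (submetric euclidean_metric K) \<and> mdist (submetric euclidean_metric K) k x < \<delta> \<longrightarrow>
        mdist ?m (G k n) (G x n) < \<eta>"
      using \<delta>1(1) \<delta>2(1) md GX k by (intro exI[of _ "min \<delta>1 \<delta>2"]) auto
  qed

  \<comment> \<open>Disjointness and local finiteness of the images\<close>
  have Grough: "\<bar>G k n (1 / real (L n)) - G k n 0\<bar> \<ge> \<epsilon> (F k n) / 4" if k: "k \<in> K" for k n
  proof -
    interpret fine_zigzag "F k n" "\<epsilon> (F k n) / 4" "L n" using fineF k .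
    show ?thesis using zigzag_step[of 0] pl_interp_node[OF L_pos, of 0 v] pl_interp_node[OF L_pos, of 1 v] L_pos
      by (simp add: G_def)
  qed
  have Gdisj: "(\<lambda>k. G k j) ` K \<inter> (\<lambda>k. G k n) ` K = {}" if jn: "j < n" for j n
  proof (rule ccontr)
    assume "\<not> ?thesis"
    \<comment> \<open>A common map would change by at least \<open>e n\<close> between 0 and
      \<open>1 / L n\<close>, being a zigzag with \<open>L n\<close> laps, but by less than
      \<open>e n\<close>, being one with only \<open>L j\<close> laps.\<close>
    then obtain k k' where kk: "k \<in> K" "k' \<in> K" "G k j = G k' n" by (auto 0 3)
    interpret fine_zigzag "F k j" "\<epsilon> (F k j) / 4" "L j" using fineF kk(1) .
    have en: "e n \<le> \<epsilon> (F k' n) / 4" "e n < 1" using e(2)[OF kk(2), of n] eps[OF FX[OF kk(2), of n]] by auto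
    \<comment> \<open>From \<open>e n < 1\<close> follows \<open>L j < L n\<close>, so 0 and
      \<open>1 / L n\<close> lie in the first lap of the coarser map.\<close>
    have "real (L n) * e n \<le> real (L n)" using en by (simp add: mult_left_le)
    then have lt: "real (L j) < real (L n)" using Lgap[OF jn] by linarith
    have Ln0: "real (L n) > 0" using Ln[of n] by simp
    have in_lap: "1 / real (L n) \<in> lap (L j) 0" "0 \<in> lap (L j) 0"
      using lt Ln0 L_pos by (auto simp: lap_iff field_simps)
    have "\<bar>v 1 - v 0\<bar> \<le> 1"
      using zigzag_in_unit[of 0] zigzag_in_unit[of 1] L_pos by auto
    then have "real (L j) * \<bar>v 1 - v 0\<bar> * (1 / real (L n)) \<le> real (L j) * 1 * (1 / real (L n))"
      by (intro mult_mono) auto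
    also have "\<dots> < e n" using Lgap[OF jn] Ln0 by (simp add: field_simps)
    finally have "\<bar>G k j (1 / real (L n)) - G k j 0\<bar> < e n"
      using pl_interp_on_lap_diff[OF L_pos in_lap, of v] by (simp add: G_def)
    then show False using Grough[OF kk(2), of n] en(1) kk(3) by simp
  qed
  have Gclosed: "closedin (mtopology_of ?m) ((\<lambda>k. G k n) ` K)" for n
  proof -
    have "compactin (mtopology_of ?m) ((\<lambda>k. G k n) ` K)"
      using K by (intro image_compactin[OF _ Gcont]) (simp add: compactin_subtopology)
    moreover have "Hausdorff_space (mtopology_of ?m)"
      unfolding mtopology_of_def by (rule Metric_space.Hausdorff_space_mtopology[OF Metric_space_mspace_mdist])
    ultimately show ?thesis by (rule compactin_imp_closedin[rotated])
  qed
  have Gloc: "\<exists>r>0. \<exists>N. \<forall>n\<ge>N. mball_of ?m g r \<inter> (\<lambda>k. G k n) ` K = {}" if "g \<in> mspace ?m" for g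
  proof -
    have g: "g \<in> X" "g \<in> CI" using that XCI by auto
    have "continuous_map (mtopology_of ?m) (mtopology_of euclidean_metric) \<epsilon>" using \<epsilon>cont by simp
    then have "\<forall>e>0. \<exists>\<rho>>0. \<forall>f. f \<in> X \<and> mdist CI_metric g f < \<rho> \<longrightarrow> dist (\<epsilon> g) (\<epsilon> f) < e"
      unfolding continuous_map_mtopology_of_iff using g(1) by simp
    moreover have "\<epsilon> g / 2 > 0" using eps(1)[OF g(1)] by simp
    ultimately obtain \<rho> where \<rho>: "\<rho> > 0"
        "\<And>f. f \<in> X \<Longrightarrow> supdist g f < \<rho> \<Longrightarrow> dist (\<epsilon> g) (\<epsilon> f) < \<epsilon> g / 2"
      using md[OF g(1)] by metis
    \<comment> \<open>The bound \<open>\<rho> / 2\<close> leaves room for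
      \<open>\<sigma> / 16 + \<sigma> < \<rho>\<close>; the bound \<open>\<epsilon> g / 2\<close> is
      the least value that \<epsilon> can approach within distance \<open>\<rho>\<close> of
      \<open>g\<close>.\<close>
    define \<sigma> where "\<sigma> = min (\<rho> / 2) (\<epsilon> g / 2)"
    have \<sigma>: "\<sigma> > 0" "\<sigma> \<le> \<rho> / 2" "\<sigma> \<le> \<epsilon> g / 2" using \<rho>(1) eps[OF g(1)] by (auto simp: \<sigma>_def)
    have "continuous_on {0..1} g" using g by (simp add: CI_def)
    then obtain \<delta> where \<delta>: "\<delta> > 0" "\<And>x. x \<in> {0..1} \<Longrightarrow> dist x 0 < \<delta> \<Longrightarrow> dist (g x) (g 0) < \<sigma> / 16"
      unfolding continuous_on_iff using \<sigma>(1)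
      by (metis atLeastAtMost_iff order_refl zero_le_one zero_less_divide_iff zero_less_numeral)
    obtain N :: nat where N: "1 / \<delta> < real N" using reals_Archimedean2 by blast
    have "G k n \<notin> mball_of ?m g (\<sigma> / 16)" if n: "n \<ge> N" and k: "k \<in> K" for n k
    proof
      assume "G k n \<in> mball_of ?m g (\<sigma> / 16)"
      then have close: "supdist g (G k n) < \<sigma> / 16" using md g GX k by simp
      have tri: "supdist g (F k n) \<le> supdist g (G k n) + supdist (F k n) (G k n)"
        using Metric_space.triangle[OF Metric_space_CI g(2) GCI[OF k, of n] FCI[OF k, of n]]
          Metric_space.commute[OF Metric_space_CI, of "F k n" "G k n"] g GCI[OF k] FCI[OF k] by simp
      \<comment> \<open>If \<open>\<epsilon> (F k n)\<close> were below \<sigma>, then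
        \<open>F k n\<close> would be within \<rho> of \<open>g\<close>, which forces
        \<open>\<epsilon> (F k n) > \<epsilon> g / 2 \<ge> \<sigma>\<close>.\<close>
      have big: "\<epsilon> (F k n) \<ge> \<sigma>"
      proof (rule ccontr)
        assume small: "\<not> ?thesis"
        then have "supdist g (F k n) < \<rho>" using tri close Gdist[OF k, of n] \<sigma> by linarith
        then have "dist (\<epsilon> g) (\<epsilon> (F k n)) < \<epsilon> g / 2" using \<rho>(2) FX k by blast
        then show False using small \<sigma>(3) unfolding dist_real_def by linarith
      qed
      define x where "x = 1 / real (L n)"
      have "real (L n) > 1 / \<delta>" using N n Ln[of n] by linarith
      then have x: "x \<in> {0..1}" "x < \<delta>" using Ln[of n] \<delta>(1) by (auto simp: x_def field_simps)
      have "\<bar>g x - g 0\<bar> < \<sigma> / 16" using \<delta>(2)[OF x(1)] x by (simp add: dist_real_def)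
      moreover have "\<bar>g x - G k n x\<bar> < \<sigma> / 16" "\<bar>g 0 - G k n 0\<bar> < \<sigma> / 16"
        using supdist_ge[OF g(2) GCI[OF k] x(1), of n] supdist_ge[OF g(2) GCI[OF k], of 0 n] close by auto
      \<comment> \<open>Between 0 and \<open>x\<close> the map \<open>G k n\<close> changes by at
        least \<open>\<sigma> / 4\<close>, whereas the three estimates allow less than
        \<open>3 * \<sigma> / 16\<close>.\<close>
      ultimately show False using Grough[OF k, of n] big \<sigma>(1) unfolding x_def by linarith
    qed
    then have "\<forall>n\<ge>N. mball_of ?m g (\<sigma> / 16) \<inter> (\<lambda>k. G k n) ` K = {}" by blast
    moreover have "\<sigma> / 16 > 0" using \<sigma>(1) by simp
    ultimately show ?thesis by blast
  qed
  show "\<exists>G. (\<forall>n. continuous_map (top_of_set K) (mtopology_of ?m) (\<lambda>k. G k n)) \<and>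
      discrete_family ?m (\<lambda>n. (\<lambda>k. G k n) ` K) \<and>
      (\<forall>k\<in>K. \<forall>n. mdist ?m (F k n) (G k n) < \<epsilon> (F k n))"
  proof (intro exI[of _ G] conjI allI ballI Gcont)
    show "discrete_family ?m (\<lambda>n. (\<lambda>k. G k n) ` K)"
      by (rule discrete_familyI[OF Gclosed Gdisj Gloc])
    show "mdist ?m (F k n) (G k n) < \<epsilon> (F k n)" if "k \<in> K" for k n
      using Gdist[OF that] md[OF FX GX] that by simp
  qed
qed

theorem theorem3:
  shows "SDAP TYPE('k::metric_space) (submetric CI_metric TI_closure) \<and>
         SDAP TYPE('k::metric_space) (submetric CI_metric TI) \<and>
         SDAP TYPE('k::metric_space) (submetric CI_metric TI_PL) \<and>
         SDAP TYPE('k::metric_space) (submetric CI_metric TI_PM)"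
proof -
  have "TI \<subseteq> TI_closure"
    unfolding TI_closure_def by (rule closure_of_subset) (auto simp: TI_def)
  moreover have "TI_PL \<subseteq> TI_PM" "TI_PM \<subseteq> TI"
    using piecewise_linear_imp_monotone by (auto simp: TI_PL_def TI_PM_def)
  ultimately show ?thesis by (intro conjI SDAP_between) auto
qed

end
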